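(* Let $K$ be Kalton's constant, i.e. the infimum of all real numbers $C \geqslant 0$ such that for every set $\Omega$, every set algebra $\mathcal{F}$ over $\Omega$, every $\Delta \geqslant 0$ and every $\Delta$-additive function $f\colon \mathcal{F}\to\mathbb{R}$ there exists a finitely-additive signed measure $\mu\colon\mathcal{F}\to\mathbb{R}$ with $$\sup_{A\in\mathcal{F}} |f(A)-\mu(A)| \leqslant C\cdot\Delta .$$ Then $K\geqslant 3$.
   Context: Let $\Omega$ be a set, $\mathcal{F}$ a set algebra over $\Omega$ (a family of subsets of $\Omega$ containing $\varnothing$ and closed under complements and finite unions), and $\Delta\geqslant 0$. A function $f\colon\mathcal{F}\to\mathbb{R}$ is called $\Delta$-additive if $f(\varnothing)=0$ and $|f(A)+f(B)-f(A\cup B)|\leqslant\Delta$ for all $A,B\in\mathcal{F}$ with $A\cap B=\varnothing$. A finitely-additive signed measure on $\mathcal{F}$ is a $0$-additive function $\mu\colon\mathcal{F}\to\mathbb{R}$. A theorem of Kalton and Roberts asserts that $K$ is finite. *)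

theory Defs
  imports "HOL-Analysis.Analysis" "HOL-Library.Infinite_Typeclass"
begin

definition delta_additive :: "'a set set \<Rightarrow> real \<Rightarrow> ('a set \<Rightarrow> real) \<Rightarrow> bool" where
  "delta_additive F \<Delta> f \<longleftrightarrow>
     f {} = 0 \<and> (\<forall>A\<in>F. \<forall>B\<in>F. A \<inter> B = {} \<longrightarrow> \<bar>f A + f B - f (A \<union> B)\<bar> \<le> \<Delta>)"

definition fa_signed_measure :: "'a set set \<Rightarrow> ('a set \<Rightarrow> real) \<Rightarrow> bool" where
  "fa_signed_measure F \<mu> \<longleftrightarrow> delta_additive F 0 \<mu>"

text \<open>HOL cannot quantify over types inside a formula, so ``for every set \<open>\<Omega>\<close>'' is rendered as
  ``for every set \<open>\<Omega>\<close> of elements of type \<open>'a\<close>''. For infinite types the choice of \<open>'a\<close> is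
  immaterial: by \<open>kalton_bound_transfer\<close> below, a constant that works for one infinite type
  works for every type. (For a finite type only finitely many algebras would be considered.)\<close>

definition kalton_bound :: "'a itself \<Rightarrow> real \<Rightarrow> bool" where
  "kalton_bound (_ :: 'a itself) C \<longleftrightarrow>
     (\<forall>(\<Omega> :: 'a set) F \<Delta> f. algebra \<Omega> F \<and> \<Delta> \<ge> 0 \<and> delta_additive F \<Delta> f \<longrightarrow>
        (\<exists>\<mu>. fa_signed_measure F \<mu> \<and> (SUP A\<in>F. ereal \<bar>f A - \<mu> A\<bar>) \<le> ereal (C * \<Delta>)))"

text \<open>The infimum is taken in the extended reals, so that it does not take an unspecified value
  in case there is no admissible \<open>C\<close>; by the Kalton--Roberts theorem that case does not occur.\<close>

definition kalton_constant :: "'a itself \<Rightarrow> ereal" where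
  "kalton_constant T = Inf {ereal C | C. C \<ge> 0 \<and> kalton_bound T C}"

lemma kalton_bound_iff:
  "kalton_bound (T :: 'a itself) C \<longleftrightarrow>
     (\<forall>(\<Omega> :: 'a set) F \<Delta> f. algebra \<Omega> F \<longrightarrow> \<Delta> \<ge> 0 \<longrightarrow> delta_additive F \<Delta> f \<longrightarrow>
        (\<exists>\<mu>. fa_signed_measure F \<mu> \<and> (\<forall>A\<in>F. \<bar>f A - \<mu> A\<bar> \<le> C * \<Delta>)))"
  by (simp add: kalton_bound_def SUP_le_iff) blast

text \<open>Finitely many sets are separated by a map into any infinite type.\<close>

lemma kalton_bound_finite_transfer:
  fixes \<Omega> :: "'b set"
  assumes K: "kalton_bound TYPE('a::infinite) C"
    and alg: "algebra \<Omega> F" and "\<Delta> \<ge> 0" and f: "delta_additive F \<Delta> f"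
    and X: "finite X" "X \<subseteq> F"
  obtains \<mu> where "\<And>A. A \<in> X \<Longrightarrow> \<bar>f A - \<mu> A\<bar> \<le> C * \<Delta>"
    and "\<And>A B. \<lbrakk>A \<in> X; B \<in> X; A \<union> B \<in> X; A \<inter> B = {}\<rbrakk> \<Longrightarrow> \<mu> A + \<mu> B = \<mu> (A \<union> B)"
proof -
  interpret algebra \<Omega> F by (rule alg)
  define h where "h x = {A \<in> X. x \<in> A}" for x
  have "finite (h ` \<Omega>)"
    by (rule finite_subset[of _ "Pow X"]) (use X in \<open>auto simp: h_def\<close>)
  then obtain e :: "'b set set \<Rightarrow> 'a" where e: "inj_on e (h ` \<Omega>)"
    using arb_inj_on_finite_infinite by blast
  define \<phi> where "\<phi> = e \<circ> h"
  define p where "p B = \<phi> -` B \<inter> \<Omega>" for B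
  define F' where "F' = {B. B \<subseteq> \<phi> ` \<Omega> \<and> p B \<in> F}"
  have p_simps: "p {} = {}" "p (A \<union> B) = p A \<union> p B" "p (A \<inter> B) = p A \<inter> p B"
    "p (\<phi> ` \<Omega> - A) = \<Omega> - p A" for A B
    by (auto simp: p_def)
  have "algebra (\<phi> ` \<Omega>) F'"
    unfolding algebra_iff_Un by (auto simp: F'_def p_simps)
  moreover have "delta_additive F' \<Delta> (\<lambda>B. f (p B))"
    using f unfolding delta_additive_def F'_def by (auto simp: p_simps simp flip: p_simps(3))
  ultimately have "\<exists>\<mu>'. fa_signed_measure F' \<mu>' \<and> (\<forall>B\<in>F'. \<bar>f (p B) - \<mu>' B\<bar> \<le> C * \<Delta>)"
    by (rule K[unfolded kalton_bound_iff, rule_format, OF _ \<open>\<Delta> \<ge> 0\<close>])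
  then obtain \<mu>' where \<mu>': "fa_signed_measure F' \<mu>'"
      "\<And>B. B \<in> F' \<Longrightarrow> \<bar>f (p B) - \<mu>' B\<bar> \<le> C * \<Delta>"
    by blast
  have sat: "p (\<phi> ` A) = A" if "A \<in> X" for A
  proof -
    have "A \<subseteq> \<Omega>" using that X sets_into_space by blast
    have "y \<in> A" if "y \<in> \<Omega>" "x \<in> A" "\<phi> y = \<phi> x" for x y
    proof -
      have "h y = h x"
        using that \<open>A \<subseteq> \<Omega>\<close> e by (auto simp: \<phi>_def dest: inj_onD)
      then show ?thesis using \<open>A \<in> X\<close> \<open>x \<in> A\<close> by (auto simp: h_def)
    qed
    then show ?thesis using \<open>A \<subseteq> \<Omega>\<close> by (auto simp: p_def)
  qed
  have im: "\<phi> ` A \<in> F'" if "A \<in> X" for A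
  proof -
    have "A \<in> F" "A \<subseteq> \<Omega>" using that X sets_into_space by blast+
    then show ?thesis using sat[OF that] by (auto simp: F'_def)
  qed
  show thesis
  proof
    show "\<bar>f A - \<mu>' (\<phi> ` A)\<bar> \<le> C * \<Delta>" if "A \<in> X" for A
      using \<mu>'(2)[OF im[OF that]] sat[OF that] by simp
    show "\<mu>' (\<phi> ` A) + \<mu>' (\<phi> ` B) = \<mu>' (\<phi> ` (A \<union> B))"
      if "A \<in> X" "B \<in> X" "A \<union> B \<in> X" "A \<inter> B = {}" for A B
    proof -
      have "\<phi> x \<noteq> \<phi> y" if "x \<in> A" "y \<in> B" for x y
      proof
        assume "\<phi> x = \<phi> y"
        moreover have "x \<in> \<Omega>"
          using \<open>x \<in> A\<close> \<open>A \<in> X\<close> X sets_into_space by blast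
        ultimately have "x \<in> p (\<phi> ` B)"
          using \<open>y \<in> B\<close> by (simp add: p_def)
        then show False
          using sat[OF \<open>B \<in> X\<close>] \<open>x \<in> A\<close> \<open>A \<inter> B = {}\<close> by blast
      qed
      then have "\<phi> ` A \<inter> \<phi> ` B = {}"
        by blast
      then show ?thesis
        using \<mu>'(1) im that(1,2) by (auto simp: fa_signed_measure_def delta_additive_def image_Un)
    qed
  qed
qed

theorem kalton_bound_transfer:
  assumes K: "kalton_bound TYPE('a::infinite) C" and "C \<ge> 0"
  shows "kalton_bound TYPE('b) C"
  unfolding kalton_bound_iff
proof (intro allI impI)
  fix \<Omega> :: "'b set" and F \<Delta> f
  assume alg: "algebra \<Omega> F" and \<Delta>: "\<Delta> \<ge> 0" and f: "delta_additive F \<Delta> f"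
  interpret algebra \<Omega> F by (rule alg)
  define S where "S = (\<Pi>\<^sub>E A\<in>UNIV. {f A - C * \<Delta> .. f A + C * \<Delta>})"
  define P where "P = {(A, B). A \<in> F \<and> B \<in> F \<and> A \<inter> B = {}}"
  define D where "D = (\<lambda>(A, B). {\<mu> :: 'b set \<Rightarrow> real. \<mu> A + \<mu> B = \<mu> (A \<union> B)})"
  have "compact S"
    unfolding S_def compactin_euclidean_iff[symmetric] euclidean_product_topology[symmetric]
    by (simp add: compactin_PiE)
  moreover have "closed T" if "T \<in> D ` P" for T
    using that by (auto simp: D_def intro!: closed_Collect_eq continuous_on_add continuous_on_product_coordinates)
  moreover have "S \<inter> \<Inter>\<T> \<noteq> {}" if "finite \<T>" "\<T> \<subseteq> D ` P" for \<T>
  proof -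
    obtain Q where Q: "finite Q" "Q \<subseteq> P" "\<T> = D ` Q"
      using \<open>finite \<T>\<close> \<open>\<T> \<subseteq> D ` P\<close> by (meson finite_subset_image)
    define X where "X = (\<Union>(A, B)\<in>Q. {A, B, A \<union> B})"
    have X: "finite X" "X \<subseteq> F"
      using Q by (auto simp: X_def P_def)
    from kalton_bound_finite_transfer[OF K alg \<Delta> f X] obtain \<mu> where
      \<mu>: "\<And>A. A \<in> X \<Longrightarrow> \<bar>f A - \<mu> A\<bar> \<le> C * \<Delta>"
        "\<And>A B. \<lbrakk>A \<in> X; B \<in> X; A \<union> B \<in> X; A \<inter> B = {}\<rbrakk> \<Longrightarrow> \<mu> A + \<mu> B = \<mu> (A \<union> B)"
      by blast
    define \<nu> where "\<nu> A = (if A \<in> X then \<mu> A else f A)" for A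
    have "\<nu> \<in> S"
      using \<mu>(1) \<open>C \<ge> 0\<close> \<Delta> by (auto simp: S_def \<nu>_def abs_le_iff algebra_simps)
    moreover have "\<nu> \<in> D (A, B)" if "(A, B) \<in> Q" for A B
    proof -
      have "A \<in> X" "B \<in> X" "A \<union> B \<in> X" "A \<inter> B = {}"
        using that Q by (auto simp: X_def P_def)
      then show ?thesis using \<mu>(2) by (simp add: D_def \<nu>_def)
    qed
    ultimately show ?thesis using Q by auto
  qed
  ultimately have "S \<inter> \<Inter>(D ` P) \<noteq> {}"
    by (rule compact_imp_fip)
  then obtain \<mu> where \<mu>: "\<mu> \<in> S" "\<And>A B. (A, B) \<in> P \<Longrightarrow> \<mu> A + \<mu> B = \<mu> (A \<union> B)"
    by (auto simp: D_def)
  have "\<mu> {} = 0"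
    using \<mu>(2)[of "{}" "{}"] by (simp add: P_def)
  then have "fa_signed_measure F \<mu>"
    using \<mu>(2) by (auto simp: fa_signed_measure_def delta_additive_def P_def)
  moreover have "\<bar>f A - \<mu> A\<bar> \<le> C * \<Delta>" for A
  proof -
    have "\<mu> A \<in> {f A - C * \<Delta> .. f A + C * \<Delta>}"
      using \<mu>(1) by (auto simp: S_def PiE_iff)
    then show ?thesis by (auto simp: abs_le_iff)
  qed
  ultimately show "\<exists>\<mu>. fa_signed_measure F \<mu> \<and> (\<forall>A\<in>F. \<bar>f A - \<mu> A\<bar> \<le> C * \<Delta>)"
    by (intro exI[of _ \<mu>]) simp
qed

corollary kalton_constant_type_independent:
  "kalton_constant TYPE('a::infinite) = kalton_constant TYPE('b::infinite)"
proof -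
  have "kalton_bound TYPE('a) C \<longleftrightarrow> kalton_bound TYPE('b) C" if "C \<ge> 0" for C
    using kalton_bound_transfer[where 'a='a and 'b='b, OF _ that]
      kalton_bound_transfer[where 'a='b and 'b='a, OF _ that] by (rule iffI)
  then have "{ereal C | C. C \<ge> 0 \<and> kalton_bound TYPE('a) C} =
      {ereal C | C. C \<ge> 0 \<and> kalton_bound TYPE('b) C}"
    by (simp cong: conj_cong)
  then show ?thesis by (simp only: kalton_constant_def)
qed

end

theory Submission
  imports Defs
begin

text \<open>
  A pairwise intersecting family \<open>S\<close> yields a 1-additive function: let it be 3 on the sets
  that contain a member of \<open>S\<close>, 1 on the other nonempty sets, and 0 on the empty set. Two disjoint
  sets cannot both contain a member of \<open>S\<close>, so for nonempty sets the only sums to compare are \<open>3 + 1\<close> with \<open>3\<close> and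
  \<open>1 + 1\<close> with \<open>1\<close> or \<open>3\<close> (lemma \<open>delta_additive_intersecting\<close>).

  If \<open>S\<close> moreover covers every point of \<open>\<Omega>\<close> equally often, but only by a small proportion of its
  members, then a measure \<open>\<mu>\<close> within \<open>C\<close> of this function has average at least \<open>3 - C\<close> over \<open>S\<close>,
  whereas this average is a small multiple of \<open>\<mu> \<Omega> \<le> 3 + C\<close>; hence \<open>C\<close> is at least nearly 3.
  Such a family is given by the \<open>m\<^sup>2\<close> crosses (the union of a row and a column) in an \<open>m \<times> m\<close> grid:
  the row of one cross meets the column of any other one, and each point lies on \<open>2 m - 1\<close> crosses
  (lemma \<open>sum_measure_crosses\<close>). So \<open>m\<^sup>2 (3 - C) \<le> (2 m - 1) (3 + C)\<close> for all \<open>m\<close>, which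
  forces \<open>C \<ge> 3\<close>.
\<close>

definition containment_value :: "'a set set \<Rightarrow> 'a set \<Rightarrow> real" where
  "containment_value S A = (if A = {} then 0 else if \<exists>X\<in>S. X \<subseteq> A then 3 else 1)"

lemma delta_additive_intersecting:
  assumes "\<And>X Y. X \<in> S \<Longrightarrow> Y \<in> S \<Longrightarrow> X \<inter> Y \<noteq> {}"
  shows "delta_additive F 1 (containment_value S)"
  unfolding delta_additive_def
proof (intro conjI ballI impI)
  show "containment_value S {} = 0"
    by (simp add: containment_value_def)
  fix A B :: "'a set"
  assume disj: "A \<inter> B = {}"
  have not_both: "\<not> ((\<exists>X\<in>S. X \<subseteq> A) \<and> (\<exists>Y\<in>S. Y \<subseteq> B))"
    using assms disj by blast
  have mono: "\<exists>X\<in>S. X \<subseteq> A \<union> B" if "(\<exists>X\<in>S. X \<subseteq> A) \<or> (\<exists>Y\<in>S. Y \<subseteq> B)"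
    using that by blast
  consider "A = {}" | "B = {}" | "A \<noteq> {}" "B \<noteq> {}" by blast
  then show "\<bar>containment_value S A + containment_value S B - containment_value S (A \<union> B)\<bar> \<le> 1"
  proof cases
    case 3
    then show ?thesis using not_both mono by (auto simp: containment_value_def)
  qed (simp_all add: containment_value_def)
qed

lemma fa_signed_measure_eq_sum:
  assumes \<mu>: "fa_signed_measure (Pow \<Omega>) \<mu>" and "finite A" "A \<subseteq> \<Omega>"
  shows "\<mu> A = (\<Sum>x\<in>A. \<mu> {x})"
  using \<open>finite A\<close> \<open>A \<subseteq> \<Omega>\<close>
proof (induction A)
  case empty
  then show ?case using \<mu> by (simp add: fa_signed_measure_def delta_additive_def)
next
  case (insert x A)
  have "\<mu> {x} + \<mu> A = \<mu> ({x} \<union> A)"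
    using \<mu> insert.hyps insert.prems by (auto simp: fa_signed_measure_def delta_additive_def)
  then show ?case using insert by simp
qed

definition grid :: "nat \<Rightarrow> (nat \<times> nat) set" where
  "grid m = {..<m} \<times> {..<m}"

definition cross :: "nat \<Rightarrow> nat \<Rightarrow> nat \<Rightarrow> (nat \<times> nat) set" where
  "cross m i j = {i} \<times> {..<m} \<union> {..<m} \<times> {j}"

text \<open>Inclusion and exclusion: summed over all crosses, the rows contribute \<open>m * \<mu> \<Omega>\<close>, so do the
  columns, and the centres are counted twice.\<close>

lemma sum_measure_crosses:
  assumes \<mu>: "fa_signed_measure (Pow (grid m)) \<mu>"
  shows "(\<Sum>i<m. \<Sum>j<m. \<mu> (cross m i j)) = (2 * real m - 1) * \<mu> (grid m)"
proof -
  define w where "w i j = \<mu> {(i, j)}" for i j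
  have total: "\<mu> (grid m) = (\<Sum>i<m. \<Sum>j<m. w i j)"
    using fa_signed_measure_eq_sum[OF \<mu>, of "grid m"]
    by (simp add: grid_def w_def sum.cartesian_product case_prod_unfold)
  have cross: "\<mu> (cross m i j) = (\<Sum>b<m. w i b) + (\<Sum>a<m. w a j) - w i j"
    if "i < m" "j < m" for i j
  proof -
    have "\<mu> (cross m i j) = (\<Sum>x\<in>{i} \<times> {..<m} \<union> {..<m} \<times> {j}. \<mu> {x})"
      using fa_signed_measure_eq_sum[OF \<mu>, of "cross m i j"] that
      by (auto simp: cross_def grid_def)
    also have "\<dots> = (\<Sum>x\<in>{i} \<times> {..<m}. \<mu> {x}) + (\<Sum>x\<in>{..<m} \<times> {j}. \<mu> {x})
        - (\<Sum>x\<in>{i} \<times> {..<m} \<inter> {..<m} \<times> {j}. \<mu> {x})"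
      by (rule sum_Un) auto
    also have "{i} \<times> {..<m} \<inter> {..<m} \<times> {j} = {(i, j)}"
      using that by auto
    also have "(\<Sum>x\<in>{i} \<times> {..<m}. \<mu> {x}) = (\<Sum>a\<in>{i}. \<Sum>b<m. w a b)"
      unfolding w_def sum.cartesian_product by (simp add: case_prod_unfold)
    also have "(\<Sum>x\<in>{..<m} \<times> {j}. \<mu> {x}) = (\<Sum>a<m. \<Sum>b\<in>{j}. w a b)"
      unfolding w_def sum.cartesian_product by (simp add: case_prod_unfold)
    finally show ?thesis by (simp add: w_def)
  qed
  have "(\<Sum>i<m. \<Sum>j<m. \<mu> (cross m i j))
      = (\<Sum>i<m. \<Sum>j<m. (\<Sum>b<m. w i b) + (\<Sum>a<m. w a j) - w i j)"
    by (simp add: cross)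
  also have "\<dots> = real m * (\<Sum>i<m. \<Sum>b<m. w i b) + real m * (\<Sum>j<m. \<Sum>a<m. w a j)
      - (\<Sum>i<m. \<Sum>j<m. w i j)"
    by (simp add: sum.distrib sum_subtractf flip: sum_distrib_left)
  also have "(\<Sum>j<m. \<Sum>a<m. w a j) = (\<Sum>i<m. \<Sum>j<m. w i j)"
    by (rule sum.swap)
  finally show ?thesis by (simp add: total algebra_simps)
qed

lemma kalton_bound_grid:
  assumes K: "kalton_bound TYPE(nat \<times> nat) C" and "m > 0"
  shows "(real m)\<^sup>2 * (3 - C) \<le> (2 * real m - 1) * (3 + C)"
proof -
  define S where "S = (\<lambda>(i, j). cross m i j) ` grid m"
  have cross_value: "containment_value S (cross m i j) = 3" if "i < m" "j < m" for i j
    using that by (auto simp: containment_value_def S_def grid_def cross_def)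
  have "cross m 0 0 \<subseteq> grid m" "cross m 0 0 \<in> S" "grid m \<noteq> {}"
    using \<open>m > 0\<close> by (auto simp: S_def grid_def cross_def)
  then have grid_value: "containment_value S (grid m) = 3"
    by (auto simp: containment_value_def)
  have "X \<inter> Y \<noteq> {}" if "X \<in> S" "Y \<in> S" for X Y
  proof -
    have "\<exists>i j. Z = cross m i j \<and> i < m \<and> j < m" if "Z \<in> S" for Z
      using that by (auto simp: S_def grid_def)
    from this[OF \<open>X \<in> S\<close>] this[OF \<open>Y \<in> S\<close>]
    obtain i j k l where "X = cross m i j" "Y = cross m k l" "i < m" "l < m"
      by blast
    \<comment> \<open>the row of \<open>X\<close> meets the column of \<open>Y\<close>\<close>
    then have "(i, l) \<in> X \<inter> Y" by (simp add: cross_def)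
    then show ?thesis by blast
  qed
  then have "delta_additive (Pow (grid m)) 1 (containment_value S)"
    by (rule delta_additive_intersecting)
  from K[unfolded kalton_bound_iff, rule_format, OF algebra_Pow _ this]
  obtain \<mu> where \<mu>: "fa_signed_measure (Pow (grid m)) \<mu>"
    and close: "\<And>A. A \<subseteq> grid m \<Longrightarrow> \<bar>containment_value S A - \<mu> A\<bar> \<le> C"
    by auto
  have "\<mu> (cross m i j) \<ge> 3 - C" if "i < m" "j < m" for i j
  proof -
    have "cross m i j \<subseteq> grid m"
      using that by (auto simp: cross_def grid_def)
    from close[OF this] show ?thesis
      using cross_value[OF that] by (simp add: abs_le_iff)
  qed
  then have "(\<Sum>i<m. \<Sum>j<m. 3 - C) \<le> (\<Sum>i<m. \<Sum>j<m. \<mu> (cross m i j))"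
    by (intro sum_mono) simp
  also have "\<dots> = (2 * real m - 1) * \<mu> (grid m)"
    by (rule sum_measure_crosses[OF \<mu>])
  also have "\<dots> \<le> (2 * real m - 1) * (3 + C)"
    using close[of "grid m"] grid_value \<open>m > 0\<close>
    by (intro mult_left_mono) (auto simp: abs_le_iff)
  finally show ?thesis by (simp add: power2_eq_square mult.assoc)
qed

lemma kalton_bound_ge_3:
  assumes "kalton_bound TYPE('a::infinite) C" and "C \<ge> 0"
  shows "C \<ge> 3"
proof (rule ccontr)
  assume "\<not> C \<ge> 3"
  then have "3 - C > 0" by simp
  obtain m where m: "2 * (3 + C) / (3 - C) < real m"
    using reals_Archimedean2 by blast
  have "0 \<le> 2 * (3 + C) / (3 - C)"
    using \<open>C \<ge> 0\<close> \<open>3 - C > 0\<close> by simp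
  with m have "m > 0" by linarith
  have large: "2 * (3 + C) < real m * (3 - C)"
    using m \<open>3 - C > 0\<close> by (simp add: pos_divide_less_eq)
  have "kalton_bound TYPE(nat \<times> nat) C"
    using assms by (rule kalton_bound_transfer)
  then have "(real m)\<^sup>2 * (3 - C) \<le> (2 * real m - 1) * (3 + C)"
    using \<open>m > 0\<close> by (rule kalton_bound_grid)
  also have "\<dots> \<le> real m * (2 * (3 + C))"
    using \<open>C \<ge> 0\<close> by (simp add: algebra_simps)
  also have "\<dots> < real m * (real m * (3 - C))"
    using large \<open>m > 0\<close> by simp
  finally show False by (simp add: power2_eq_square mult.assoc)
qed

theorem mainTheorem1:
  shows "kalton_constant TYPE('a::infinite) \<ge> 3"
  unfolding kalton_constant_def
proof (rule Inf_greatest)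
  fix x assume "x \<in> {ereal C | C. C \<ge> 0 \<and> kalton_bound TYPE('a) C}"
  then obtain C where C: "x = ereal C" "C \<ge> 0" "kalton_bound TYPE('a) C"
    by blast
  then have "C \<ge> 3"
    by (blast intro: kalton_bound_ge_3)
  then show "3 \<le> x"
    by (simp add: C(1))
qed

end
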